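(* Let $n$ be a positive integer and let $\mathcal{B}_n$ be the collection of up-step sets of all Dyck paths of length $2n$. Then $\mathcal{B}_n$ is the collection of bases of a matroid (on the ground set $[2n]=\{1,\dots,2n\}$).
   Context: A Dyck path of length $2n$ is a path in the plane from $(0,0)$ to $(2n,0)$, with steps $(1,1)$ (up-steps) and $(1,-1)$ (down-steps), that never passes below the $x$-axis. The up-step set of a path is the set of integers $i\in[2n]$ for which the $i$-th step of the path is $(1,1)$. *)

theory Defs
  imports Main "HOL-Library.Product_Plus"
begin

locale matroid =
  fixes E :: "'a set" and indep :: "'a set set"
  assumes finite_ground: "finite E"
    and indep_subset_ground: "X \<in> indep \<Longrightarrow> X \<subseteq> E"
    and empty_indep: "{} \<in> indep"
    and subset_indep: "X \<in> indep \<Longrightarrow> Y \<subseteq> X \<Longrightarrow> Y \<in> indep"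
    and augmentation: "X \<in> indep \<Longrightarrow> Y \<in> indep \<Longrightarrow> card X < card Y
           \<Longrightarrow> \<exists>y\<in>Y - X. insert y X \<in> indep"

definition bases_of :: "'a set set \<Rightarrow> 'a set set" where
  "bases_of indep = {B \<in> indep. \<forall>X\<in>indep. B \<subseteq> X \<longrightarrow> X = B}"

text \<open>A lattice path starting at the origin is given by its list of steps; the point reached
  after \<open>k\<close> steps is the sum of the first \<open>k\<close> steps. As each step advances the first
  coordinate by one, the end point fixes the length of the list. The path is linear between
  consecutive lattice points, so it suffices that none of these lies below the axis.\<close>

definition point_after :: "(int \<times> int) list \<Rightarrow> nat \<Rightarrow> int \<times> int" where
  "point_after s k = sum_list (take k s)"

definition dyck_path :: "nat \<Rightarrow> (int \<times> int) list \<Rightarrow> bool" where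
  "dyck_path n s \<longleftrightarrow>
     set s \<subseteq> {(1, 1), (1, -1)} \<and>
     point_after s (length s) = (2 * int n, 0) \<and>
     (\<forall>k \<le> length s. 0 \<le> snd (point_after s k))"

text \<open>Steps are numbered from 1, list positions from 0.\<close>

definition up_step_set :: "(int \<times> int) list \<Rightarrow> nat set" where
  "up_step_set s = {i \<in> {1..length s}. s ! (i - 1) = (1, 1)}"

definition dyck_up_step_sets :: "nat \<Rightarrow> nat set set" where
  "dyck_up_step_sets n = {up_step_set s | s. dyck_path n s}"

end

theory Submission
  imports Defs
begin

text \<open>A set of size \<open>n\<close> contains at least half of each initial segment \<open>{1..k}\<close> iff it has at
  most \<open>(2n - k) / 2\<close> elements beyond \<open>k\<close>. The latter bounds are inherited by subsets, so they
  define the independent sets, and since the segments are nested, augmentation works by adding an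
  element that lies before the first tight bound.\<close>

definition dyck_indep :: "nat \<Rightarrow> nat set set" where
  "dyck_indep n = {X. X \<subseteq> {1..2 * n} \<and> (\<forall>k \<le> 2 * n. 2 * card (X \<inter> {k<..}) + k \<le> 2 * n)}"

lemma dyck_indep_finite: "X \<in> dyck_indep n \<Longrightarrow> finite X"
  by (auto simp: dyck_indep_def intro: finite_subset)

lemma card_split_at:
  fixes X :: "'a::linorder set"
  assumes "finite X"
  shows "card X = card (X \<inter> {..k}) + card (X \<inter> {k<..})"
proof -
  have "X = (X \<inter> {..k}) \<union> (X \<inter> {k<..})" by auto
  then have "card X = card ((X \<inter> {..k}) \<union> (X \<inter> {k<..}))" by simp
  also have "\<dots> = card (X \<inter> {..k}) + card (X \<inter> {k<..})"
    using assms by (intro card_Un_disjoint) auto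
  finally show ?thesis .
qed

text \<open>This is the bound at \<open>k = 0\<close>, where the final segment contains all of
  \<open>X\<close>.\<close>

lemma dyck_indep_card_le:
  assumes "X \<in> dyck_indep n"
  shows "card X \<le> n"
proof -
  have "X \<inter> {0<..} = X" "2 * card (X \<inter> {0<..}) + 0 \<le> 2 * n"
    using assms by (auto simp: dyck_indep_def)
  then show ?thesis by simp
qed

lemma dyck_indep_augment:
  assumes X: "X \<in> dyck_indep n" and Y: "Y \<in> dyck_indep n" and less: "card X < card Y"
  shows "\<exists>y\<in>Y - X. insert y X \<in> dyck_indep n"
proof -
  \<comment> \<open>Tightness at \<open>k\<close> means that one further element beyond
    \<open>k\<close> would break the bound there.\<close>
  define tight where "tight k \<longleftrightarrow> 2 * n < 2 * (card (X \<inter> {k<..}) + 1) + k" for k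
  define m where "m = (LEAST k. tight k)"
  \<comment> \<open>At \<open>2 * n\<close> there is no slack, so a least tight index
    \<open>m\<close> exists and lies in the range of the bounds.\<close>
  have "tight (2 * n)" by (simp add: tight_def)
  then have m: "tight m" "m \<le> 2 * n"
    unfolding m_def by (auto intro: LeastI Least_le)
  have fin: "finite X" "finite Y" using X Y dyck_indep_finite by auto
  have "2 * card (Y \<inter> {m<..}) + m \<le> 2 * n" using Y m(2) by (simp add: dyck_indep_def)
  \<comment> \<open>Beyond \<open>m\<close>, \<open>X\<close> is as large as any independent set can
    be, so the surplus of \<open>Y\<close> must lie in \<open>{..m}\<close>.\<close>
  then have "card (Y \<inter> {m<..}) \<le> card (X \<inter> {m<..})" using m(1) by (simp add: tight_def)
  then have "card (X \<inter> {..m}) < card (Y \<inter> {..m})"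
    using less card_split_at[OF fin(1), of m] card_split_at[OF fin(2), of m] by linarith
  then have "\<not> Y \<inter> {..m} \<subseteq> X \<inter> {..m}"
    using fin card_mono[of "X \<inter> {..m}" "Y \<inter> {..m}"] by auto
  then obtain y where y: "y \<in> Y" "y \<notin> X" "y \<le> m" by auto
  \<comment> \<open>Adding \<open>y\<close> changes only the counts for \<open>k < y\<close>. These
    \<open>k\<close> are below \<open>m\<close>, hence not tight, and leave room for one more
    element.\<close>
  have "2 * card (insert y X \<inter> {k<..}) + k \<le> 2 * n" if k: "k \<le> 2 * n" for k
  proof (cases "k < y")
    case True
    then have "\<not> tight k" using y(3) not_less_Least[of k tight] by (simp add: m_def)
    moreover have "card (insert y X \<inter> {k<..}) \<le> card (X \<inter> {k<..}) + 1"
      using True fin y(2) by (simp add: Int_insert_left)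
    ultimately show ?thesis by (simp add: tight_def)
  next
    case False
    then have "insert y X \<inter> {k<..} = X \<inter> {k<..}" by auto
    then show ?thesis using X k by (simp add: dyck_indep_def)
  qed
  moreover have "insert y X \<subseteq> {1..2 * n}" using X Y y by (auto simp: dyck_indep_def)
  ultimately show ?thesis using y by (auto simp: dyck_indep_def)
qed

lemma matroid_dyck_indep: "matroid {1..2 * n} (dyck_indep n)"
proof
  fix X Y assume X: "X \<in> dyck_indep n" and "Y \<subseteq> X"
  have "card (Y \<inter> {k<..}) \<le> card (X \<inter> {k<..})" for k
    using \<open>Y \<subseteq> X\<close> dyck_indep_finite[OF X] by (intro card_mono) auto
  then have "2 * card (Y \<inter> {k<..}) + k \<le> 2 * card (X \<inter> {k<..}) + k" for k by simp
  then show "Y \<in> dyck_indep n"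
    using X \<open>Y \<subseteq> X\<close> unfolding dyck_indep_def by (blast intro: order_trans)
qed (auto simp: dyck_indep_augment, auto simp: dyck_indep_def)

text \<open>Shows that the size \<open>n\<close> is attained. The set belongs to the path with
  \<open>n\<close> up-steps followed by \<open>n\<close> down-steps.\<close>

lemma atLeastAtMost_in_dyck_indep: "{1..n} \<in> dyck_indep n"
proof -
  have "{1..n} \<inter> {k<..} = {k<..n}" for k by auto
  then show ?thesis by (auto simp: dyck_indep_def)
qed

text \<open>An independent set with fewer than \<open>n\<close> elements can be augmented from
  \<open>{1..n}\<close>, so it is not maximal; one with \<open>n\<close> elements already has the
  largest possible size.\<close>

lemma bases_of_dyck_indep: "bases_of (dyck_indep n) = {B \<in> dyck_indep n. card B = n}"
proof (intro set_eqI iffI)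
  fix B assume B: "B \<in> bases_of (dyck_indep n)"
  then have ind: "B \<in> dyck_indep n" by (simp add: bases_of_def)
  have "\<not> card B < card {1..n}"
    using B dyck_indep_augment[OF ind atLeastAtMost_in_dyck_indep]
    by (auto simp: bases_of_def)
  then show "B \<in> {B \<in> dyck_indep n. card B = n}" using ind dyck_indep_card_le[OF ind] by simp
next
  fix B assume "B \<in> {B \<in> dyck_indep n. card B = n}"
  moreover have "X = B" if "X \<in> dyck_indep n" "B \<subseteq> X" "card B = n" for X
    using that dyck_indep_card_le dyck_indep_finite card_seteq by metis
  ultimately show "B \<in> bases_of (dyck_indep n)" by (auto simp: bases_of_def)
qed

text \<open>The parts of \<open>B\<close> up to \<open>k\<close> and beyond \<open>k\<close> have
  \<open>n\<close> elements together, which turns the upper bound on the second into the ballot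
  condition on the first.\<close>

lemma dyck_indep_basis_iff:
  "B \<in> dyck_indep n \<and> card B = n \<longleftrightarrow>
     B \<subseteq> {1..2 * n} \<and> card B = n \<and> (\<forall>k \<le> 2 * n. k \<le> 2 * card (B \<inter> {..k}))"
proof -
  have "2 * card (B \<inter> {k<..}) + k \<le> 2 * n \<longleftrightarrow> k \<le> 2 * card (B \<inter> {..k})"
    if "B \<subseteq> {1..2 * n}" "card B = n" for k
  proof -
    have "finite B" using that(1) by (rule finite_subset) simp
    from card_split_at[OF this, of k] show ?thesis using that(2) by linarith
  qed
  then show ?thesis by (auto simp: dyck_indep_def)
qed

text \<open>With \<open>u\<close> up-steps among the first \<open>k\<close> steps there are
  \<open>k - u\<close> down-steps, giving height \<open>u - (k - u)\<close>.\<close>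

lemma point_after_up_step_set:
  assumes "set s \<subseteq> {(1, 1), (1, -1)}" and "k \<le> length s"
  shows "point_after s k = (int k, 2 * int (card (up_step_set s \<inter> {..k})) - int k)"
  using assms(2)
proof (induction k)
  case 0
  have "up_step_set s \<inter> {..0} = {}" by (auto simp: up_step_set_def)
  then show ?case by (simp add: point_after_def zero_prod_def)
next
  case (Suc k)
  have fin: "finite (up_step_set s)" by (simp add: up_step_set_def)
  have step: "point_after s (Suc k) = point_after s k + s ! k"
    using Suc.prems by (simp add: point_after_def take_Suc_conv_app_nth)
  have "s ! k \<in> {(1, 1), (1, -1)}"
    using subsetD[OF assms(1) nth_mem] Suc.prems by simp
  then consider "s ! k = (1, 1)" | "s ! k = (1, -1)" by auto
  then show ?case
  proof cases
    case 1
    \<comment> \<open>List position \<open>k\<close> holds step number \<open>Suc k\<close>.\<close>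
    then have "up_step_set s \<inter> {..Suc k} = insert (Suc k) (up_step_set s \<inter> {..k})"
      using Suc.prems by (auto simp: up_step_set_def le_Suc_eq)
    then show ?thesis using 1 step Suc fin by simp
  next
    case 2
    then have "up_step_set s \<inter> {..Suc k} = up_step_set s \<inter> {..k}"
      by (auto simp: up_step_set_def le_Suc_eq)
    then show ?thesis using 2 step Suc by simp
  qed
qed

text \<open>The height \<open>2 * u - k\<close> vanishes at the end exactly when half of the steps
  go up, and it is nonnegative exactly when \<open>k \<le> 2 * u\<close>.\<close>

lemma dyck_path_iff:
  assumes "set s \<subseteq> {(1, 1), (1, -1)}"
  shows "dyck_path n s \<longleftrightarrow> length s = 2 * n \<and> card (up_step_set s) = n \<and>
    (\<forall>k \<le> 2 * n. k \<le> 2 * card (up_step_set s \<inter> {..k}))"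
proof -
  have "up_step_set s \<inter> {..length s} = up_step_set s" by (auto simp: up_step_set_def)
  then have "point_after s (length s) = (2 * int n, 0) \<longleftrightarrow>
      length s = 2 * n \<and> card (up_step_set s) = n"
    using point_after_up_step_set[OF assms order_refl] by auto
  moreover have "0 \<le> snd (point_after s k) \<longleftrightarrow> k \<le> 2 * card (up_step_set s \<inter> {..k})"
    if "k \<le> length s" for k
    using point_after_up_step_set[OF assms that] by auto
  ultimately show ?thesis using assms by (auto simp: dyck_path_def)
qed

lemma ex_steps_up_step_set:
  assumes "B \<subseteq> {1..m}"
  obtains s where "set s \<subseteq> {(1, 1), (1, -1)}" "length s = m" "up_step_set s = B"
proof
  let ?s = "map (\<lambda>i. if Suc i \<in> B then (1, 1) else (1, -1)) [0..<m] :: (int \<times> int) list"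
  show "set ?s \<subseteq> {(1, 1), (1, -1)}" "length ?s = m" by auto
  show "up_step_set ?s = B"
  proof (intro set_eqI)
    fix i
    show "i \<in> up_step_set ?s \<longleftrightarrow> i \<in> B"
      \<comment> \<open>The case \<open>i = 0\<close> is separate because \<open>i - 1\<close>
        truncates; 0 belongs to neither set.\<close>
      using assms by (cases i) (auto simp: up_step_set_def split: if_splits)
  qed
qed

lemma dyck_up_step_sets_eq: "dyck_up_step_sets n = {B \<in> dyck_indep n. card B = n}"
proof (intro set_eqI iffI)
  fix B assume "B \<in> dyck_up_step_sets n"
  then obtain s where s: "dyck_path n s" "B = up_step_set s"
    by (auto simp: dyck_up_step_sets_def)
  then have "set s \<subseteq> {(1, 1), (1, -1)}" by (simp add: dyck_path_def)
  then have path: "length s = 2 * n" "card B = n" "\<forall>k \<le> 2 * n. k \<le> 2 * card (B \<inter> {..k})"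
    using s dyck_path_iff by auto
  then have "B \<subseteq> {1..2 * n}" using s(2) by (auto simp: up_step_set_def)
  then show "B \<in> {B \<in> dyck_indep n. card B = n}"
    using path dyck_indep_basis_iff[of B n] by blast
next
  fix B assume "B \<in> {B \<in> dyck_indep n. card B = n}"
  then have B: "B \<subseteq> {1..2 * n}" "card B = n" "\<forall>k \<le> 2 * n. k \<le> 2 * card (B \<inter> {..k})"
    using dyck_indep_basis_iff[of B n] by blast+
  obtain s where s: "set s \<subseteq> {(1, 1), (1, -1)}" "length s = 2 * n" "up_step_set s = B"
    using ex_steps_up_step_set[OF B(1)] .
  then have "dyck_path n s" using B dyck_path_iff[OF s(1)] by simp
  then show "B \<in> dyck_up_step_sets n" using s(3) by (auto simp: dyck_up_step_sets_def)
qed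

theorem theorem2p1:
  fixes n :: nat
  assumes "n \<ge> 1"
  shows "\<exists>indep. matroid {1..2 * n} indep \<and> bases_of indep = dyck_up_step_sets n"
  using matroid_dyck_indep bases_of_dyck_indep dyck_up_step_sets_eq by metis

end
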